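(* Let $n=2t$, let $s$ be a positive integer coprime with $t$ and let $\xi\in\mathbb{F}_{q^{2t}}$ be such that $\{1,\xi\}$ is an $\mathbb{F}_{q^t}$-basis of $\mathbb{F}_{q^{2t}}$. Let $\mu\in\mathbb{F}_{q^t}$ with $\mathrm{N}_{q^t/q}(\mu)\ne1$ and $\mathrm{N}_{q^t/q}(-\xi^{q^t+1}\mu)\ne(-1)^t$. Let $U=T\times S$ where $T=\{v+\xi\mu v^{q^s}\colon v\in\mathbb{F}_{q^t}\}$ and $S=\{u+\xi u^{q^s}\colon u\in\mathbb{F}_{q^t}\}$. Let $\{u_0,\dots,u_{t-1}\}$ be an $\mathbb{F}_q$-basis of $\mathbb{F}_{q^t}$ and let $(\lambda_0^*,\dots,\lambda_{n-1}^* )$ be the dual basis of \[(u_0+\mu u_0^{q^s}\xi,\dots,u_{t-1}+\mu u_{t-1}^{q^s}\xi,\ u_0+u_0^{q^s}\xi,\dots,u_{t-1}+u_{t-1}^{q^s}\xi).\] Then $L_U$ is $\mathrm{P}\Gamma\mathrm{L}(2,q^n)$-equivalent to $L_p$, where \[p(x)=\sum_{k=0}^{n-1}\Big(\sum_{\ell=0}^{t-1}(u_\ell+u_\ell^{q^s}\xi)\,{\lambda^*_{t+\ell}}^{q^k}\Big)x^{q^k}.\]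
   Context: Two ordered $\mathbb{F}_q$-bases $(\xi_i)$, $(\xi_i^* )$ of $\mathbb{F}_{q^n}$ are dual if $\mathrm{Tr}_{q^n/q}(\xi_i\xi_j^* )=\delta_{ij}$. $\mathrm{N}_{q^t/q}$ is the norm from $\mathbb{F}_{q^t}$ to $\mathbb{F}_q$. For an $\mathbb{F}_q$-subspace $U$ of $\mathbb{F}_{q^n}^2$, $L_U=\{\langle\mathbf u\rangle_{\mathbb{F}_{q^n}}\colon\mathbf u\in U\setminus\{\mathbf0\}\}$; for a $q$-polynomial $p$, $L_p=\{\langle(x,p(x))\rangle_{\mathbb{F}_{q^n}}\colon x\in\mathbb{F}_{q^n}^*\}$. *)

theory Defs
  imports
    "HOL-Algebra.Embedded_Algebras"
    "HOL-Algebra.Algebraic_Closure_Type"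
    "HOL-Computational_Algebra.Primes"
    "HOL-Library.Product_Plus"
begin

abbreviation subfield_of_type :: "'a::field set \<Rightarrow> bool" where
  "subfield_of_type K \<equiv> subfield K ring_of_type_algebra"

(* Ordered bases are lists; V is a K-subspace of the ambient field. *)
definition ordered_basis :: "'a::field set \<Rightarrow> 'a list \<Rightarrow> 'a set \<Rightarrow> bool" where
  "ordered_basis K bs V \<longleftrightarrow>
     ring.independent ring_of_type_algebra K bs \<and> ring.Span ring_of_type_algebra K bs = V"

(* Trace and norm of the extension of degree m of the field with q elements. When the extension
   is a proper subfield of the type, they are meaningful only on its elements. *)
definition gf_trace :: "nat \<Rightarrow> nat \<Rightarrow> 'a::field \<Rightarrow> 'a" where
  "gf_trace q m x = (\<Sum>i<m. x ^ (q ^ i))"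

definition gf_norm :: "nat \<Rightarrow> nat \<Rightarrow> 'a::field \<Rightarrow> 'a" where
  "gf_norm q m x = (\<Prod>i<m. x ^ (q ^ i))"

(* K is the subfield with q elements, and the whole type is the extension of K of degree n. *)
definition dual_bases :: "'a::field set \<Rightarrow> nat \<Rightarrow> nat \<Rightarrow> 'a list \<Rightarrow> 'a list \<Rightarrow> bool" where
  "dual_bases K q n bs ds \<longleftrightarrow>
     ordered_basis K bs UNIV \<and> ordered_basis K ds UNIV \<and>
     length bs = n \<and> length ds = n \<and>
     (\<forall>i<n. \<forall>j<n. gf_trace q n (bs ! i * ds ! j) = (if i = j then 1 else 0))"

definition scale2 :: "'a::field \<Rightarrow> 'a \<times> 'a \<Rightarrow> 'a \<times> 'a" where
  "scale2 c v = (c * fst v, c * snd v)"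

(* A point of PG(1, F) is represented by the one-dimensional subspace itself. *)
definition point :: "'a::field \<times> 'a \<Rightarrow> ('a \<times> 'a) set" where
  "point v = range (\<lambda>c. scale2 c v)"

definition linear_set :: "('a::field \<times> 'a) set \<Rightarrow> ('a \<times> 'a) set set" where
  "linear_set U = {point u | u. u \<in> U - {0}}"

definition linear_set_of_map :: "('a::field \<Rightarrow> 'a) \<Rightarrow> ('a \<times> 'a) set set" where
  "linear_set_of_map p = {point (x, p x) | x. x \<noteq> 0}"

definition field_automorphism :: "('a::field \<Rightarrow> 'a) \<Rightarrow> bool" where
  "field_automorphism \<sigma> \<longleftrightarrow>
     bij \<sigma> \<and> (\<forall>x y. \<sigma> (x + y) = \<sigma> x + \<sigma> y) \<and> (\<forall>x y. \<sigma> (x * y) = \<sigma> x * \<sigma> y)"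

definition GammaL2 :: "('a::field \<times> 'a \<Rightarrow> 'a \<times> 'a) set" where
  "GammaL2 = {f. bij f \<and> (\<forall>v w. f (v + w) = f v + f w) \<and>
     (\<exists>\<sigma>. field_automorphism \<sigma> \<and> (\<forall>c v. f (scale2 c v) = scale2 (\<sigma> c) (f v)))}"

(* The elements of PGammaL(2, F) are the maps on points induced by elements of GammaL(2, F). *)
definition PGammaL2_equivalent ::
    "('a::field \<times> 'a) set set \<Rightarrow> ('a \<times> 'a) set set \<Rightarrow> bool" where
  "PGammaL2_equivalent L L' \<longleftrightarrow> (\<exists>f\<in>GammaL2. (\<lambda>P. f ` P) ` L = L')"

end

theory Submission
  imports Defs
begin

text \<open>
  Since $\mu \neq 1$, the spaces $T$ and $S$ intersect trivially, so the given list is a basis of the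
  whole field, and its dual basis reads off coordinates by traces. Hence
  $p(x) = \sum_\ell b_{t+\ell}\, \mathrm{Tr}(\lambda^*_{t+\ell} x)$ is the projection onto $S$
  along $T$, and the linear map $(a, b) \mapsto (a + b, b)$ carries $T \times S$ onto the graph of $p$.
\<close>

section \<open>Bases over a subfield, expressed by sums with coefficient functions\<close>

lemma combine_eq_sum:
  assumes "length Ks = length Us"
  shows "ring.combine ring_of_type_algebra Ks Us = (\<Sum>i<length Us. Ks ! i * (Us ! i :: 'a::field))"
  using assms
proof (induction Ks Us rule: list_induct2)
  case Nil
  then show ?case
    by (simp add: ring.combine.simps[OF ring_from_type_algebra]) (simp add: ring_of_type_algebra_def)
next
  case (Cons x xs y ys)
  then show ?case
    by (simp add: ring.combine.simps[OF ring_from_type_algebra] sum.lessThan_Suc_shift del: sum.lessThan_Suc)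
      (simp add: ring_of_type_algebra_def)
qed

lemma subfield_of_type_closed:
  fixes K :: "'a::field set"
  assumes "subfield_of_type K"
  shows "0 \<in> K" "1 \<in> K" "x \<in> K \<Longrightarrow> y \<in> K \<Longrightarrow> x + y \<in> K" "x \<in> K \<Longrightarrow> y \<in> K \<Longrightarrow> x * y \<in> K"
    "x \<in> K \<Longrightarrow> - x \<in> K"
proof -
  note R = subfieldE[OF assms]
  interpret F: field "ring_of_type_algebra :: 'a ring" by (rule field_from_type_algebra)
  have sr: "subring K ring_of_type_algebra" using R(1) by (simp add: subcring_def)
  note S = subringE[OF sr]
  show "0 \<in> K" "1 \<in> K" "x \<in> K \<Longrightarrow> y \<in> K \<Longrightarrow> x + y \<in> K" "x \<in> K \<Longrightarrow> y \<in> K \<Longrightarrow> x * y \<in> K"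
    using S(2,3,6,7) by (simp_all add: ring_of_type_algebra_def)
  show "- x \<in> K" if "x \<in> K"
  proof -
    have "\<ominus>\<^bsub>ring_of_type_algebra\<^esub> x = - x"
      by (rule F.minus_equality) (simp_all add: ring_of_type_algebra_def)
    then show ?thesis using S(5)[OF that] by simp
  qed
qed

text \<open>This is the bridge from the list recursion behind \<open>combine\<close> to indexed
  sums. Coefficients become functions on indices, so that later arguments can split, shift and
  concatenate them freely.\<close>

lemma ordered_basis_iff:
  fixes K :: "'a::field set"
  assumes K: "subfield_of_type K"
  shows "ordered_basis K bs V \<longleftrightarrow>
    (\<forall>c. (\<forall>i<length bs. c i \<in> K) \<longrightarrow> (\<Sum>i<length bs. c i * bs ! i) = 0 \<longrightarrow> (\<forall>i<length bs. c i = 0)) \<and>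
    V = {\<Sum>i<length bs. c i * bs ! i | c. \<forall>i<length bs. c i \<in> K}" (is "_ \<longleftrightarrow> ?ind \<and> V = ?span")
proof -
  interpret F: field "ring_of_type_algebra :: 'a ring" by (rule field_from_type_algebra)
  have carr: "carrier (ring_of_type_algebra :: 'a ring) = UNIV" and
    zero: "\<zero>\<^bsub>ring_of_type_algebra\<^esub> = (0 :: 'a)"
    by (simp_all add: ring_of_type_algebra_def)
  have ex_list: "\<exists>Ks. set Ks \<subseteq> K \<and> length Ks = length bs \<and> (\<forall>i<length bs. Ks ! i = c i)"
    if "\<forall>i<length bs. c i \<in> K" for c
    by (rule exI[of _ "map c [0..<length bs]"]) (use that in auto)
  have "F.Span K bs = {F.combine Ks bs | Ks. length Ks = length bs \<and> set Ks \<subseteq> K}"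
    by (rule F.Span_eq_combine_set_length_version[OF K]) (simp add: carr)
  also have "\<dots> = ?span"
  proof (intro equalityI subsetI)
    fix x assume "x \<in> {F.combine Ks bs | Ks. length Ks = length bs \<and> set Ks \<subseteq> K}"
    then obtain Ks where "x = F.combine Ks bs" "length Ks = length bs" "set Ks \<subseteq> K" by blast
    then show "x \<in> ?span" by (auto simp: combine_eq_sum intro!: exI[of _ "nth Ks"])
  next
    fix x assume "x \<in> ?span"
    then obtain c where c: "x = (\<Sum>i<length bs. c i * bs ! i)" "\<forall>i<length bs. c i \<in> K" by blast
    obtain Ks where "set Ks \<subseteq> K" "length Ks = length bs" "\<forall>i<length bs. Ks ! i = c i"
      using ex_list[OF c(2)] by blast
    then show "x \<in> {F.combine Ks bs | Ks. length Ks = length bs \<and> set Ks \<subseteq> K}"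
      by (auto simp: c combine_eq_sum intro!: exI[of _ Ks])
  qed
  finally have span: "F.Span K bs = ?span" .
  have ind: "F.independent K bs \<longleftrightarrow> ?ind"
  proof
    assume I: "F.independent K bs"
    show ?ind
    proof (intro allI impI)
      fix c i assume c: "\<forall>i<length bs. c i \<in> K" "(\<Sum>i<length bs. c i * bs ! i) = 0" and i: "i < length bs"
      obtain Ks where Ks: "set Ks \<subseteq> K" "length Ks = length bs" "\<forall>i<length bs. Ks ! i = c i"
        using ex_list[OF c(1)] by blast
      have "F.combine Ks bs = \<zero>\<^bsub>ring_of_type_algebra\<^esub>"
        using c(2) Ks by (simp add: combine_eq_sum zero)
      from F.independent_imp_trivial_combine[OF K I Ks(1) this]
      have "set Ks \<subseteq> {0}" using Ks(2) by (simp add: zero)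
      then show "c i = 0" using Ks(2,3) i by (metis nth_mem singletonD subsetD)
    qed
  next
    assume I: ?ind
    show "F.independent K bs"
    proof (rule F.trivial_combine_imp_independent[OF K])
      fix Ks assume Ks: "set Ks \<subseteq> K" "F.combine Ks bs = \<zero>\<^bsub>ring_of_type_algebra\<^esub>"
      \<comment> \<open>The independence criterion quantifies over coefficient lists of any length,
        while \<open>?ind\<close> speaks of exactly \<open>length bs\<close> coefficients. Since
        \<open>combine\<close> ignores surplus entries and treats missing ones as zero, truncating
        or padding \<open>Ks\<close> keeps its value.\<close>
      define Ks' where "Ks' = take (length bs) Ks @ replicate (length bs - length Ks) 0"
      have len: "length Ks' = length bs" by (simp add: Ks'_def)
      have set: "set Ks' \<subseteq> K"
        using Ks(1) subfield_of_type_closed(1)[OF K] by (auto simp: Ks'_def dest: in_set_takeD)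
      have "F.combine Ks' bs = F.combine Ks bs"
      proof (cases "length Ks \<le> length bs")
        case True
        then show ?thesis
          by (simp add: Ks'_def) (metis F.combine_append_replicate zero carr subset_UNIV)
      next
        case False
        then show ?thesis by (simp add: Ks'_def F.combine_take)
      qed
      then have "(\<Sum>i<length bs. Ks' ! i * bs ! i) = 0" using Ks(2) by (simp only: combine_eq_sum[OF len] zero)
      then have *: "\<forall>i<length bs. Ks' ! i = 0"
        using I[rule_format, of "nth Ks'"] set len by (metis nth_mem subsetD)
      then have "set Ks' \<subseteq> {0}" using len by (auto simp: in_set_conv_nth)
      then show "set (take (length bs) Ks) \<subseteq> {\<zero>\<^bsub>ring_of_type_algebra\<^esub>}" by (auto simp: Ks'_def zero)
    qed (simp add: carr)
  qed
  show ?thesis unfolding ordered_basis_def span ind by blast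
qed

section \<open>Powers of the Frobenius map relative to a subfield with q elements\<close>

locale finite_field_extension =
  fixes K :: "'a::finite_field set" and q n :: nat
  assumes subfield: "subfield_of_type K"
    and card_K: "card K = q"
    and card_UNIV: "card (UNIV :: 'a set) = q ^ n"
    and n_pos: "n > 0"
begin

lemmas K_closed = subfield_of_type_closed[OF subfield]

lemma q_gt_1: "q > 1"
proof -
  have "card {0, 1 :: 'a} \<le> card K" by (rule card_mono) (use K_closed in auto)
  then show ?thesis by (simp add: card_K)
qed

text \<open>Multiplication by a nonzero x permutes the nonzero elements of \<open>K\<close>;
  comparing the product of all of them before and after gives
  \<open>x ^ (q - 1) = 1\<close>.\<close>

lemma power_q_fixed:
  assumes "x \<in> K" shows "x ^ q = x"
proof (cases "x = 0")
  case True
  then show ?thesis using q_gt_1 by simp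
next
  case False
  have "(*) x ` (K - {0}) = K - {0}"
    by (rule endo_inj_surj) (use False assms K_closed in \<open>auto simp: inj_on_def\<close>)
  then have "bij_betw ((*) x) (K - {0}) (K - {0})"
    using False by (auto simp: bij_betw_def inj_on_def)
  then have "(\<Prod>z\<in>K - {0}. z) = (\<Prod>z\<in>K - {0}. x * z)"
    using prod.reindex_bij_betw[of "(*) x" _ _ "\<lambda>z. z"] by simp
  also have "\<dots> = x ^ card (K - {0}) * (\<Prod>z\<in>K - {0}. z)" by (simp add: prod.distrib)
  finally have "x ^ card (K - {0}) = 1" by simp
  then have "x ^ (q - 1) = 1" using card_K K_closed(1) by simp
  then show ?thesis using q_gt_1 by (simp add: power_eq_if)
qed

lemma power_q_pow_Suc: "x ^ (q ^ Suc k) = ((x :: 'a) ^ (q ^ k)) ^ q"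
  by (simp only: power_Suc2 power_mult)

lemma power_q_pow_fixed: "x \<in> K \<Longrightarrow> x ^ (q ^ k) = x"
  by (induction k) (simp_all add: power_q_pow_Suc power_q_fixed del: power_Suc)

text \<open>The polynomial $(X+1)^q - X^q - 1$ has degree less than $q$ and vanishes on the $q$ elements of $K$.\<close>

lemma power_q_add_1: "(x + 1) ^ q = x ^ q + (1 :: 'a)"
proof -
  define D :: "'a poly" where "D = [:1, 1:] ^ q - [:0, 1:] ^ q - 1"
  have poly_D: "poly D x = (x + 1) ^ q - x ^ q - 1" for x
    by (simp add: D_def add.commute)
  have deg: "degree ([:a, 1:] ^ q) = q" for a :: 'a by (simp add: degree_power_eq)
  have lead: "coeff ([:a, 1:] ^ q) q = 1" for a :: 'a
    using lead_coeff_power[of "[:a, 1:]" q] by (simp add: deg)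
  have "degree D \<le> q" unfolding D_def by (intro degree_diff_le) (simp_all add: deg)
  moreover have "coeff D q = 0" using q_gt_1 by (simp add: D_def lead)
  ultimately have D: "D = 0 \<or> degree D < q" by (rule eq_zero_or_degree_less)
  have "K \<subseteq> {x. poly D x = 0}"
    using K_closed(2,3) by (auto simp: poly_D power_q_fixed)
  then have "q \<le> card {x. poly D x = 0}" using card_mono[of "{x. poly D x = 0}" K] by (simp add: card_K)
  then have "D = 0" using D card_poly_roots_bound[of D] by fastforce
  then show ?thesis using poly_D[of x] by (simp add: algebra_simps)
qed

text \<open>Both sides are homogeneous of degree q, so dividing by a nonzero y reduces the claim to
  the case y = 1.\<close>

lemma power_q_add: "(x + y) ^ q = x ^ q + (y :: 'a) ^ q"
proof (cases "y = 0")
  case True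
  then show ?thesis using q_gt_1 by simp
next
  case False
  then have "(x + y) ^ q = ((x / y + 1) * y) ^ q" by (simp add: distrib_right)
  also have "\<dots> = ((x / y) ^ q + 1) * y ^ q" by (simp only: power_mult_distrib power_q_add_1)
  finally show ?thesis using False by (simp add: power_divide distrib_right)
qed

lemma power_q_pow_add: "(x + y) ^ (q ^ k) = x ^ (q ^ k) + (y :: 'a) ^ (q ^ k)"
  by (induction k) (simp_all add: power_q_pow_Suc power_q_add del: power_Suc)

lemma power_q_pow_zero [simp]: "(0 :: 'a) ^ (q ^ k) = 0"
  using q_gt_1 by (simp add: power_0_left)

lemma power_q_pow_sum: "(\<Sum>i\<in>A. f i) ^ (q ^ k) = (\<Sum>i\<in>A. (f i :: 'a) ^ (q ^ k))"
  by (induction A rule: infinite_finite_induct) (simp_all add: power_q_pow_add)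

lemma power_q_pow_minus: "(- x) ^ (q ^ k) = - ((x :: 'a) ^ (q ^ k))"
  using power_q_pow_add[of x "- x" k] by (simp add: eq_neg_iff_add_eq_0 add.commute)

text \<open>The polynomial X^q - X has at most q roots, and \<open>K\<close> already supplies q of
  them. This turns membership in \<open>K\<close> into an equation that can be checked for
  traces.\<close>

lemma in_K_iff: "x \<in> K \<longleftrightarrow> x ^ q = x"
proof -
  define P :: "'a poly" where "P = monom 1 q - monom 1 1"
  have roots: "{x. poly P x = 0} = {x. x ^ q = x}" by (simp add: P_def poly_monom)
  have "coeff P q \<noteq> 0" using q_gt_1 by (simp add: P_def)
  then have "P \<noteq> 0" by auto
  moreover have "degree P \<le> q" unfolding P_def using q_gt_1
    by (intro degree_diff_le order.trans[OF degree_monom_le]) auto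
  ultimately have "card {x :: 'a. x ^ q = x} \<le> card K"
    using card_poly_roots_bound[of P] by (simp add: roots card_K)
  then have "K = {x. x ^ q = x}"
    by (intro card_seteq) (auto simp: power_q_fixed)
  then show ?thesis by blast
qed

section \<open>The trace to K: its values, linearity and non-vanishing\<close>

lemma gf_trace_in_K: "gf_trace q n x \<in> K"
proof -
  obtain m where m: "n = Suc m" using n_pos by (cases n) auto
  have "gf_trace q n x ^ q = (\<Sum>i<n. x ^ (q ^ Suc i))"
    using power_q_pow_sum[of "\<lambda>i. x ^ (q ^ i)" "{..<n}" 1]
    by (simp add: gf_trace_def power_q_pow_Suc del: power_Suc)
  also have "\<dots> = (\<Sum>i<m. x ^ (q ^ Suc i)) + x ^ (q ^ n)" by (simp add: m)
  \<comment> \<open>Raising to the power q shifts the conjugates by one place; the last one wraps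
    around to x because the whole field has q^n elements.\<close>
  also have "x ^ (q ^ n) = x" using finite_field_power_card_eq_same[of x] by (simp add: card_UNIV)
  also have "(\<Sum>i<m. x ^ (q ^ Suc i)) + x = gf_trace q n x"
    by (simp add: gf_trace_def m sum.lessThan_Suc_shift del: sum.lessThan_Suc)
  finally show ?thesis by (simp add: in_K_iff)
qed

lemma gf_trace_add: "gf_trace q m (x + y) = gf_trace q m x + gf_trace q m (y :: 'a)"
  by (simp add: gf_trace_def power_q_pow_add sum.distrib)

lemma gf_trace_diff: "gf_trace q m (x - y) = gf_trace q m x - gf_trace q m (y :: 'a)"
  using gf_trace_add[of m "x - y" y] by simp

lemma gf_trace_sum: "gf_trace q m (\<Sum>i\<in>A. f i) = (\<Sum>i\<in>A. gf_trace q m (f i :: 'a))"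
  by (simp add: gf_trace_def power_q_pow_sum) (rule sum.swap)

lemma gf_trace_scale: "c \<in> K \<Longrightarrow> gf_trace q m (c * x) = c * gf_trace q m x"
  by (simp add: gf_trace_def power_mult_distrib power_q_pow_fixed sum_distrib_left)

text \<open>The trace is a nonzero polynomial function of degree at most q^(n-1), so it has too few
  roots to vanish on all q^n elements.\<close>

lemma gf_trace_nonzero: "\<exists>x :: 'a. gf_trace q n x \<noteq> 0"
proof (rule ccontr)
  define P :: "'a poly" where "P = (\<Sum>i<n. monom 1 (q ^ i))"
  assume "\<not> ?thesis"
  then have roots: "{x. poly P x = 0} = UNIV"
    by (auto simp: P_def poly_sum poly_monom gf_trace_def)
  \<comment> \<open>Because q > 1, the exponents q^i are pairwise distinct, so only the summand i =
    n - 1 contributes to this coefficient.\<close>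
  have "coeff P (q ^ (n - 1)) = (\<Sum>i<n. if i = n - 1 then 1 else 0)"
    using q_gt_1 by (simp add: P_def coeff_sum)
  also have "\<dots> = 1" using n_pos by simp
  finally have "P \<noteq> 0" by auto
  moreover have "degree P \<le> q ^ (n - 1)" unfolding P_def
    by (intro degree_sum_le order.trans[OF degree_monom_le])
      (use q_gt_1 in \<open>auto intro!: power_increasing\<close>)
  ultimately have "q ^ n \<le> q ^ (n - 1)"
    using card_poly_roots_bound[of P] by (simp add: roots card_UNIV)
  moreover have "q ^ (n - 1) < q ^ n" using q_gt_1 n_pos by (intro power_strict_increasing) auto
  ultimately show False by simp
qed

section \<open>Bases of the whole field, and existence and uniqueness of dual bases\<close>

lemma ordered_basis_UNIV_I:
  assumes len: "length bs = n"
    and ind: "\<And>c i. (\<And>i. i < n \<Longrightarrow> c i \<in> K) \<Longrightarrow> (\<Sum>i<n. c i * bs ! i) = 0 \<Longrightarrow> i < n \<Longrightarrow> c i = 0"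
  shows "ordered_basis K bs UNIV"
proof -
  let ?C = "PiE {..<n} (\<lambda>_. K)" and ?f = "\<lambda>c. \<Sum>i<n. c i * bs ! i"
  \<comment> \<open>Independence makes the map from coefficient vectors to linear combinations
    injective. Its domain has q^n elements, as many as the field, so spanning follows by
    counting.\<close>
  have "inj_on ?f ?C"
  proof (rule inj_onI)
    fix c d assume cd: "c \<in> ?C" "d \<in> ?C" "?f c = ?f d"
    then have "(\<Sum>i<n. (c i - d i) * bs ! i) = 0" by (simp add: algebra_simps sum_subtractf)
    moreover have "c i - d i \<in> K" if "i < n" for i
      using K_closed(3)[of "c i" "- d i"] K_closed(5)[of "d i"] cd(1,2) that by auto
    ultimately have "c i - d i = 0" if "i < n" for i
      using ind[of "\<lambda>i. c i - d i" i] that by blast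
    then show "c = d" using cd(1,2) by (intro PiE_ext[of _ "{..<n}" "\<lambda>_. K"]) auto
  qed
  then have "card (?f ` ?C) = card (UNIV :: 'a set)"
    by (simp add: card_image card_PiE card_K card_UNIV)
  then have surj: "?f ` ?C = UNIV" by (intro card_subset_eq) auto
  have "\<exists>c. x = ?f c \<and> (\<forall>i<n. c i \<in> K)" for x
  proof -
    obtain c where "c \<in> ?C" "x = ?f c" using surj by blast
    then show ?thesis by auto
  qed
  then show ?thesis unfolding ordered_basis_iff[OF subfield] len using ind by blast
qed

text \<open>For nonzero x, every z equals (z / x) * x with z / x in the span of \<open>bs\<close>.
  Traces vanishing on all \<open>bs ! i * x\<close> would therefore make the trace vanish
  everywhere.\<close>

lemma gf_trace_nondegenerate:
  assumes bs: "ordered_basis K bs UNIV" "length bs = n"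
    and 0: "\<And>i. i < n \<Longrightarrow> gf_trace q n (bs ! i * x) = 0"
  shows "x = 0"
proof (rule ccontr)
  assume "x \<noteq> 0"
  obtain z :: 'a where z: "gf_trace q n z \<noteq> 0" using gf_trace_nonzero by blast
  have "z / x \<in> UNIV" by simp
  then obtain c where c: "z / x = (\<Sum>i<n. c i * bs ! i)" "\<forall>i<n. c i \<in> K"
    using bs unfolding ordered_basis_iff[OF subfield] by blast
  have "z = (\<Sum>i<n. c i * (bs ! i * x))"
    using \<open>x \<noteq> 0\<close> c(1) by (simp add: field_simps sum_distrib_left)
  then have "gf_trace q n z = (\<Sum>i<n. c i * gf_trace q n (bs ! i * x))"
    using c(2) by (simp add: gf_trace_sum gf_trace_scale)
  then show False using z 0 by simp
qed

text \<open>Only one dual vector y is involved, and \<open>bs\<close> need not be known to be a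
  basis. The lemma can thus serve with the two families exchanged, to prove that the dual family is
  independent, and later to evaluate the map p.\<close>

lemma gf_trace_coordinate:
  assumes dual: "\<And>i. i < n \<Longrightarrow> gf_trace q n (bs ! i * y) = (if i = j then 1 else 0)"
    and c: "\<And>i. i < n \<Longrightarrow> c i \<in> K" and j: "j < n"
  shows "gf_trace q n (y * (\<Sum>i<n. c i * bs ! i)) = c j"
proof -
  have "y * (\<Sum>i<n. c i * bs ! i) = (\<Sum>i<n. c i * (bs ! i * y))"
    by (simp add: sum_distrib_left mult_ac)
  then have "gf_trace q n (y * (\<Sum>i<n. c i * bs ! i)) = (\<Sum>i<n. c i * gf_trace q n (bs ! i * y))"
    using c by (simp add: gf_trace_sum gf_trace_scale)
  also have "\<dots> = (\<Sum>i<n. if i = j then c i else 0)" using dual by (intro sum.cong) auto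
  finally show ?thesis using j by simp
qed

text \<open>By nondegeneracy the vector of traces against \<open>bs\<close> determines x, and there
  are q^n elements and q^n vectors over \<open>K\<close>. Every vector is therefore attained:
  preimages of the unit vectors form the dual basis, and injectivity makes it unique.\<close>

lemma dual_bases_ex1:
  assumes bs: "ordered_basis K bs UNIV" "length bs = n"
  shows "\<exists>!ls. dual_bases K q n bs ls"
proof -
  let ?C = "PiE {..<n} (\<lambda>_. K)" and ?g = "\<lambda>x. \<lambda>i\<in>{..<n}. gf_trace q n (bs ! i * x)"
  have sep: "x = y" if "\<And>i. i < n \<Longrightarrow> gf_trace q n (bs ! i * x) = gf_trace q n (bs ! i * y)" for x y
    using gf_trace_nondegenerate[OF bs, of "x - y"] that by (simp add: gf_trace_diff algebra_simps)
  have "inj ?g"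
  proof (rule injI)
    fix x y assume eq: "?g x = ?g y"
    show "x = y"
    proof (rule sep)
      fix i assume "i < n"
      then show "gf_trace q n (bs ! i * x) = gf_trace q n (bs ! i * y)"
        using fun_cong[OF eq, of i] by simp
    qed
  qed
  then have card: "card (range ?g) = card ?C"
    by (simp add: card_image card_PiE card_K card_UNIV)
  have "range ?g \<subseteq> ?C" by (intro image_subsetI restrict_PiE_iff[THEN iffD2]) (simp add: gf_trace_in_K)
  then have surj: "range ?g = ?C" by (intro card_subset_eq finite_PiE card) simp_all
  have "\<exists>x. \<forall>i<n. gf_trace q n (bs ! i * x) = (if i = j then 1 else 0)" for j
  proof -
    have "(\<lambda>i\<in>{..<n}. if i = j then 1 else 0) \<in> ?C"
      using K_closed(1,2) by (simp add: restrict_PiE_iff)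
    then obtain x where x: "?g x = (\<lambda>i\<in>{..<n}. if i = j then 1 else 0)"
      unfolding surj[symmetric] by (elim imageE) simp
    have "gf_trace q n (bs ! i * x) = (if i = j then 1 else 0)" if "i < n" for i
      using fun_cong[OF x, of i] that by simp
    then show ?thesis by blast
  qed
  then obtain y where y: "\<And>i j. i < n \<Longrightarrow> gf_trace q n (bs ! i * y j) = (if i = j then 1 else 0)"
    by metis
  define ls where "ls = map y [0..<n]"
  have "ordered_basis K ls UNIV"
  proof (rule ordered_basis_UNIV_I)
    show "length ls = n" by (simp add: ls_def)
    fix c j assume c: "\<And>i. i < n \<Longrightarrow> c i \<in> K" "(\<Sum>i<n. c i * ls ! i) = 0" and j: "j < n"
    \<comment> \<open>The roles are exchanged here: multiplying by \<open>bs ! j\<close> and taking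
      the trace extracts the j-th coefficient of a combination of \<open>ls\<close>.\<close>
    have "gf_trace q n (bs ! j * (\<Sum>i<n. c i * ls ! i)) = c j"
      by (rule gf_trace_coordinate) (use c j y in \<open>auto simp: ls_def mult.commute[of _ "bs ! j"]\<close>)
    then show "c j = 0" using c(2) by (simp add: gf_trace_def)
  qed
  then have "dual_bases K q n bs ls" using bs y by (simp add: dual_bases_def ls_def)
  moreover have "ls' = ls" if "dual_bases K q n bs ls'" for ls'
  proof (rule nth_equalityI)
    show "length ls' = length ls" using that by (simp add: dual_bases_def ls_def)
    fix i assume i: "i < length ls'"
    show "ls' ! i = ls ! i" 
      by (rule sep) (use that y i in \<open>auto simp: dual_bases_def ls_def\<close>)
  qed
  ultimately show ?thesis by (rule ex1I)
qed

end

section \<open>From a product of complementary sets to the graph of a projection\<close>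

lemma linear_set_graph_equivalent:
  fixes T S :: "'a::field set"
  assumes proj: "\<And>x. p x \<in> S \<and> x - p x \<in> T"
    and p_0: "p 0 = 0"
    and unique: "\<And>a b. a \<in> T \<Longrightarrow> b \<in> S \<Longrightarrow> p (a + b) = b"
  shows "PGammaL2_equivalent (linear_set (T \<times> S)) (linear_set_of_map p)"
proof -
  define f :: "'a \<times> 'a \<Rightarrow> 'a \<times> 'a" where "f = (\<lambda>(a, b). (a + b, b))"
  have f_scale: "f (scale2 c v) = scale2 c (f v)" for c v
    by (cases v) (simp add: f_def scale2_def algebra_simps)
  have "bij f"
    by (rule o_bij[of "\<lambda>(a, b). (a - b, b)"]) (auto simp: f_def)
  moreover have "f (v + w) = f v + f w" for v w
    by (cases v; cases w) (simp add: f_def)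
  moreover have "field_automorphism (\<lambda>x :: 'a. x)" by (simp add: field_automorphism_def bij_def)
  ultimately have f: "f \<in> GammaL2" using f_scale unfolding GammaL2_def by blast
  have f_point: "f ` point v = point (f v)" for v
    by (simp add: point_def image_image f_scale)
  have "(\<lambda>P. f ` P) ` linear_set (T \<times> S) = linear_set_of_map p"
  proof (intro equalityI subsetI)
    fix P assume "P \<in> (\<lambda>P. f ` P) ` linear_set (T \<times> S)"
    then obtain a b where ab: "a \<in> T" "b \<in> S" "(a, b) \<noteq> 0" "P = f ` point (a, b)"
      unfolding linear_set_def by auto
    have p: "p (a + b) = b" using unique ab by blast
    \<comment> \<open>If a + b were 0, then b = p 0 = 0 and hence a = 0, against the choice of a
      nonzero vector.\<close>
    then have "a + b \<noteq> 0" using p_0 ab(3) by (auto simp: zero_prod_def)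
    then show "P \<in> linear_set_of_map p"
      unfolding linear_set_of_map_def ab(4) f_point by (auto simp: f_def p intro!: exI[of _ "a + b"])
  next
    fix P assume "P \<in> linear_set_of_map p"
    then obtain x where x: "x \<noteq> 0" "P = point (x, p x)" unfolding linear_set_of_map_def by blast
    \<comment> \<open>This is the preimage of (x, p x) under f; it is nonzero because its components
      add up to x.\<close>
    have "(x - p x, p x) \<in> T \<times> S - {0}" using proj[of x] x(1) by (auto simp: zero_prod_def)
    moreover have "P = f ` point (x - p x, p x)" unfolding f_point by (simp add: x f_def)
    ultimately show "P \<in> (\<lambda>P. f ` P) ` linear_set (T \<times> S)" unfolding linear_set_def by blast
  qed
  then show ?thesis unfolding PGammaL2_equivalent_def using f by blast
qed

section \<open>The decomposition of the field into T and S, and the projection given by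
  traces\<close>

theorem theorem4p19:
  fixes q n t s :: nat
    and Fq Fqt T S :: "'a::finite_field set"
    and \<xi> \<mu> :: 'a
    and us bs :: "'a list"
  assumes "t \<ge> 1" and "n = 2 * t" and "card (UNIV :: 'a set) = q ^ n"
    and "subfield_of_type Fq" and "card Fq = q"
    and "subfield_of_type Fqt" and "card Fqt = q ^ t"
    and "s > 0" and "coprime s t"
    and "ordered_basis Fqt [1, \<xi>] UNIV"
    and "\<mu> \<in> Fqt"
    and "gf_norm q t \<mu> \<noteq> 1"
    and "gf_norm q t (- (\<xi> ^ (q ^ t + 1) * \<mu>)) \<noteq> (- 1) ^ t"
    and "T = {v + \<xi> * \<mu> * v ^ (q ^ s) | v. v \<in> Fqt}"
    and "S = {u + \<xi> * u ^ (q ^ s) | u. u \<in> Fqt}"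
    and "length us = t" and "ordered_basis Fq us Fqt"
    and "bs = map (\<lambda>u. u + \<mu> * u ^ (q ^ s) * \<xi>) us @ map (\<lambda>u. u + u ^ (q ^ s) * \<xi>) us"
  shows "(\<exists>!ls. dual_bases Fq q n bs ls) \<and>
    (\<forall>ls. dual_bases Fq q n bs ls \<longrightarrow>
      PGammaL2_equivalent
        (linear_set (T \<times> S))
        (linear_set_of_map (\<lambda>x. \<Sum>k<n.
          (\<Sum>l<t. (us ! l + (us ! l) ^ (q ^ s) * \<xi>) * (ls ! (t + l)) ^ (q ^ k)) * x ^ (q ^ k))))"
proof -
  interpret finite_field_extension Fq q n
    by (rule finite_field_extension.intro) (use assms(1-5) in simp_all)
  let ?T = "\<lambda>v. v + \<mu> * v ^ (q ^ s) * \<xi>" and ?S = "\<lambda>u. u + u ^ (q ^ s) * \<xi>"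
  let ?comb = "\<lambda>c. \<Sum>l<t. c l * us ! l"
  have T: "T = ?T ` Fqt" and S: "S = ?S ` Fqt"
    using assms(14,15) by (auto simp: mult_ac)
  have us_ind: "c l = 0" if "\<And>i. i < t \<Longrightarrow> c i \<in> Fq" "?comb c = 0" "l < t" for c l
    using assms(16,17) that unfolding ordered_basis_iff[OF subfield] by blast
  have us_span: "Fqt = {?comb c | c. \<forall>i<t. c i \<in> Fq}"
    using assms(16,17) unfolding ordered_basis_iff[OF subfield] by blast
  have us_mem: "?comb c \<in> Fqt" if "\<And>i. i < t \<Longrightarrow> c i \<in> Fq" for c
    using us_span that by blast
  have \<xi>_ind: "a = 0 \<and> b = 0" if "a \<in> Fqt" "b \<in> Fqt" "a + b * \<xi> = 0" for a b
  proof -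
    have *: "(\<forall>i<length [1, \<xi>]. c i \<in> Fqt) \<longrightarrow> (\<Sum>i<length [1, \<xi>]. c i * [1, \<xi>] ! i) = 0 \<longrightarrow>
        (\<forall>i<length [1, \<xi>]. c i = 0)" for c
      using assms(10) unfolding ordered_basis_iff[OF assms(6)] by blast
    show ?thesis using *[of "\<lambda>i. if i = 0 then a else b"] that by (simp add: All_less_Suc)
  qed
  note Fqt = subfield_of_type_closed[OF assms(6)]
  have Fqt_pow: "x ^ k \<in> Fqt" if "x \<in> Fqt" for x k
    using that by (induction k) (auto simp: Fqt)
  \<comment> \<open>The norm of 1 is 1, so the hypothesis on the norm of \<mu> excludes this
    value.\<close>
  have "\<mu> \<noteq> 1" using assms(12) by (auto simp: gf_norm_def)
  \<comment> \<open>Coefficients in \<open>Fq\<close> are fixed by powers of the Frobenius map, so u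
    \<mapsto> u^(q^s) is linear over \<open>Fq\<close>.\<close>
  have lin: "?comb c ^ (q ^ s) = (\<Sum>l<t. c l * (us ! l) ^ (q ^ s))" if "\<And>i. i < t \<Longrightarrow> c i \<in> Fq" for c
    using that by (simp add: power_q_pow_sum power_mult_distrib power_q_pow_fixed)
  have len: "length bs = n" using assms by simp
  have bs_T: "bs ! l = ?T (us ! l)" and bs_S: "bs ! (t + l) = ?S (us ! l)" if "l < t" for l
    using that assms(16,18) by (simp_all add: nth_append)
  have comb_T: "?T (?comb c) = (\<Sum>l<t. c l * bs ! l)"
    and comb_S: "?S (?comb c) = (\<Sum>l<t. c l * bs ! (t + l))" if "\<And>i. i < t \<Longrightarrow> c i \<in> Fq" for c
    by (simp_all add: lin[OF that] bs_T bs_S sum_distrib_left sum_distrib_right sum.distrib distrib_left mult_ac)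
  have split: "(\<Sum>i<n. c i * bs ! i) = (\<Sum>l<t. c l * bs ! l) + (\<Sum>l<t. c (t + l) * bs ! (t + l))" for c
  proof -
    have "(\<Sum>i<t + m. f i) = (\<Sum>i<t. f i) + (\<Sum>i<m. f (t + i))" for f :: "nat \<Rightarrow> 'a" and m
      by (induction m) (simp_all add: add.assoc)
    then show ?thesis by (simp add: assms(2) mult_2)
  qed
  \<comment> \<open>This says at once that the parametrisations \<open>?T\<close> and
    \<open>?S\<close> have trivial kernel and that T and S meet only in 0. Comparing coefficients of
    1 and \<xi> gives w = -v and then (\<mu> - 1) v^(q^s) = 0.\<close>
  have direct: "v = 0 \<and> w = 0" if "v \<in> Fqt" "w \<in> Fqt" "?T v + ?S w = 0" for v w
  proof -
    have "(v + w) + (\<mu> * v ^ (q ^ s) + w ^ (q ^ s)) * \<xi> = 0"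
      using that(3) by (simp add: algebra_simps)
    then have eq: "v + w = 0 \<and> \<mu> * v ^ (q ^ s) + w ^ (q ^ s) = 0"
      using that(1,2) assms(11) by (intro \<xi>_ind) (auto simp: Fqt Fqt_pow)
    then have w: "w = - v" by (simp add: eq_neg_iff_add_eq_0 add.commute)
    then have "(\<mu> - 1) * v ^ (q ^ s) = 0" using eq by (simp add: power_q_pow_minus algebra_simps)
    then show ?thesis using \<open>\<mu> \<noteq> 1\<close> w by simp
  qed
  have basis: "ordered_basis Fq bs UNIV"
  proof (rule ordered_basis_UNIV_I[OF len])
    fix c i assume c: "\<And>i. i < n \<Longrightarrow> c i \<in> Fq" "(\<Sum>i<n. c i * bs ! i) = 0" and i: "i < n"
    \<comment> \<open>The first t coefficients of a combination of \<open>bs\<close> describe its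
      component in T, the last t its component in S; both are coordinates with respect to
      \<open>us\<close>.\<close>
    let ?d = "\<lambda>l. c (t + l)"
    have cK: "\<And>l. l < t \<Longrightarrow> c l \<in> Fq" "\<And>l. l < t \<Longrightarrow> ?d l \<in> Fq" using c(1) assms(2) by auto
    have "?comb c = 0 \<and> ?comb ?d = 0"
    proof (rule direct)
      show "?comb c \<in> Fqt" "?comb ?d \<in> Fqt" using us_mem[of c] us_mem[of ?d] cK by simp_all
      show "?T (?comb c) + ?S (?comb ?d) = 0"
        using c(2) comb_T[of c, OF cK(1)] comb_S[of ?d, OF cK(2)] split[of c] by simp
    qed
    then have "c l = 0" "?d l = 0" if "l < t" for l
      using us_ind[of c] us_ind[of ?d] cK that by blast+
    then show "c i = 0" using i assms(2) by (cases "i < t") (auto dest: le_Suc_ex simp: not_less)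
  qed
  show ?thesis
  proof (intro conjI allI impI)
    show "\<exists>!ls. dual_bases Fq q n bs ls" by (rule dual_bases_ex1[OF basis len])
  next
    fix ls assume ls: "dual_bases Fq q n bs ls"
    let ?p = "\<lambda>x. \<Sum>k<n. (\<Sum>l<t. ?S (us ! l) * (ls ! (t + l)) ^ (q ^ k)) * x ^ (q ^ k)"
    \<comment> \<open>Exchanging the two sums collects, for each l, the powers of
      \<open>ls ! (t + l) * x\<close> into a trace.\<close>
    have p: "?p x = (\<Sum>l<t. gf_trace q n (ls ! (t + l) * x) * bs ! (t + l))" for x
    proof -
      have "?p x = (\<Sum>k<n. \<Sum>l<t. bs ! (t + l) * (ls ! (t + l) * x) ^ (q ^ k))"
        by (simp add: bs_S sum_distrib_left sum_distrib_right power_mult_distrib mult_ac)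
      also have "\<dots> = (\<Sum>l<t. \<Sum>k<n. bs ! (t + l) * (ls ! (t + l) * x) ^ (q ^ k))" by (rule sum.swap)
      finally show ?thesis by (simp add: gf_trace_def sum_distrib_left mult_ac)
    qed
    \<comment> \<open>These traces are the last t coordinates with respect to \<open>bs\<close>, so
      \<open>?p\<close> discards the component in T and keeps the one in S.\<close>
    have p_comb: "?p (\<Sum>i<n. c i * bs ! i) = (\<Sum>l<t. c (t + l) * bs ! (t + l))"
      if "\<And>i. i < n \<Longrightarrow> c i \<in> Fq" for c
      unfolding p
    proof (intro sum.cong refl)
      fix l assume "l \<in> {..<t}"
      then have "t + l < n" using assms(2) by simp
      then show "gf_trace q n (ls ! (t + l) * (\<Sum>i<n. c i * bs ! i)) * bs ! (t + l) = c (t + l) * bs ! (t + l)"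
        using ls that by (subst gf_trace_coordinate[where j = "t + l"]) (auto simp: dual_bases_def)
    qed
    show "PGammaL2_equivalent (linear_set (T \<times> S)) (linear_set_of_map ?p)"
    proof (rule linear_set_graph_equivalent)
      fix x :: 'a
      have "x \<in> UNIV" by simp
      then obtain c where c: "x = (\<Sum>i<n. c i * bs ! i)" "\<And>i. i < n \<Longrightarrow> c i \<in> Fq"
        using basis len unfolding ordered_basis_iff[OF subfield] by blast
      let ?d = "\<lambda>l. c (t + l)"
      have cK: "\<And>l. l < t \<Longrightarrow> c l \<in> Fq" "\<And>l. l < t \<Longrightarrow> ?d l \<in> Fq" using c(2) assms(2) by auto
      have "?comb c \<in> Fqt" "?comb ?d \<in> Fqt" using us_mem[of c] us_mem[of ?d] cK by simp_all
      moreover have "?p x = ?S (?comb ?d)" using p_comb[of c] c comb_S[of ?d] cK by simp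
      moreover have "x - ?p x = ?T (?comb c)"
        using p_comb[of c] c comb_T[of c] cK by (simp add: split)
      ultimately show "?p x \<in> S \<and> x - ?p x \<in> T" unfolding T S by blast
    next
      show "?p 0 = 0" by simp
    next
      fix a b assume "a \<in> T" "b \<in> S"
      then obtain v w where vw: "v \<in> Fqt" "a = ?T v" "w \<in> Fqt" "b = ?S w" unfolding T S by blast
      then obtain c d where cd: "v = ?comb c" "\<And>i. i < t \<Longrightarrow> c i \<in> Fq" "w = ?comb d" "\<And>i. i < t \<Longrightarrow> d i \<in> Fq"
        using us_span by blast
      \<comment> \<open>Concatenating the coordinates of v and w with respect to \<open>us\<close>
        gives the coordinates of a + b with respect to \<open>bs\<close>, whence the shift by
        t.\<close>
      define e where "e i = (if i < t then c i else d (i - t))" for i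
      have e: "e i \<in> Fq" if "i < n" for i using cd that assms(2) by (auto simp: e_def)
      have "a + b = (\<Sum>i<n. e i * bs ! i)"
        unfolding split using cd comb_T[of c] comb_S[of d] by (simp add: vw e_def)
      then show "?p (a + b) = b" using p_comb[of e] e comb_S[of d] cd by (simp add: vw e_def)
    qed
  qed
qed

end
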